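(* Let $X$ be a complex Fréchet space. Then $X$ satisfies condition $(LB_\infty)$ of Vogt if and only if every Dirichlet series $D=\sum_n a_n\frac1{n^s}$ with coefficients $a_n\in X$ such that $\sigma_c(x'(D))<+\infty$ for all $x'\in X'$ also satisfies $\sigma_c(D)<+\infty$.
   Context: $X'$ denotes the topological dual of $X$. For a Dirichlet series $D=\sum_n a_n\frac1{n^s}$ with coefficients in $X$ (variable $s\in\mathbb{C}$), the abscissa of convergence is $\sigma_c(D):=\inf\{r\in\mathbb{R} : \sum_n a_n\frac1{n^s}\text{ converges in }X\text{ for all } s \text{ with } \operatorname{Re}s>r\}$, the infimum being taken in the extended real line (so $\sigma_c(D)=+\infty$ if the series is nowhere convergent). For $x'\in X'$, $x'(D)$ denotes the scalar Dirichlet series $\sum_n x'(a_n)\frac1{n^s}$, and $\sigma_c(x'(D))$ is its abscissa of convergence (same definition with $X=\mathbb{C}$). Condition $(LB_\infty)$: let $(\|\cdot\|_k)_{k\in\mathbb{N}}$ be an increasing fundamental system of continuous seminorms of the Fréchet space $X$. Then $X$ satisfies $(LB_\infty)$ if for every increasing sequence $(\rho_m)_{m\in\mathbb{N}}$ of positive reals with $\rho_m\to\infty$ there is $p\in\mathbb{N}$ such that for every $q\in\mathbb{N}$ there are $n_0\in\mathbb{N}$, $n_0\ge q$, and $C>0$ such that for every $x\in X$ there is $m\in\mathbb{N}$ with $q\le m\le n_0$ and $\|x\|_q^{1+\rho_m}\le C\,\|x\|_m\,\|x\|_p^{\rho_m}$. (The condition does not depend on the chosen fundamental system. By a theorem of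 Vogt, recalled in the paper, $X$ satisfies $(LB_\infty)$ if and only if every continuous linear operator from the Fréchet space of rapidly decreasing sequences, i.e. sequences $(\gamma_n)_n\subset\mathbb{C}$ with $(n^k\gamma_n)_n$ bounded for every $k\in\mathbb{N}$, into $X$ maps some neighbourhood of $0$ into a bounded set.) *)

theory Defs
  imports "HOL-Analysis.Analysis"
begin

text \<open>The library has no class of complex topological vector spaces. Such a space is given here by
  a type of class \<open>topological_ab_group_add\<close> (continuous addition and negation) together with its
  scalar multiplication.\<close>

locale complex_tvs = vector_space smul
  for smul :: "complex \<Rightarrow> 'a::topological_ab_group_add \<Rightarrow> 'a" +
  assumes continuous_scale: "continuous_on UNIV (\<lambda>(c, x). smul c x)"

definition convex_wrt :: "(complex \<Rightarrow> 'a::ab_group_add \<Rightarrow> 'a) \<Rightarrow> 'a set \<Rightarrow> bool" where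
  "convex_wrt smul S \<longleftrightarrow>
    (\<forall>x\<in>S. \<forall>y\<in>S. \<forall>u\<ge>0. \<forall>v\<ge>0. u + v = 1 \<longrightarrow>
      smul (complex_of_real u) x + smul (complex_of_real v) y \<in> S)"

locale frechet_space = complex_tvs smul
  for smul :: "complex \<Rightarrow> 'a::topological_ab_group_add \<Rightarrow> 'a" +
  assumes locally_convex:
    "\<And>U. open U \<Longrightarrow> 0 \<in> U \<Longrightarrow> \<exists>V. open V \<and> 0 \<in> V \<and> V \<subseteq> U \<and> convex_wrt smul V"
  and complete_invariant_metric:
    "\<exists>d :: 'a \<Rightarrow> 'a \<Rightarrow> real. Metric_space UNIV d \<and> (\<forall>x y z. d (x + z) (y + z) = d x y) \<and>
         Metric_space.mtopology UNIV d = euclidean \<and> Metric_space.mcomplete UNIV d"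

definition topological_dual ::
    "(complex \<Rightarrow> 'a::topological_ab_group_add \<Rightarrow> 'a) \<Rightarrow> ('a \<Rightarrow> complex) set" where
  "topological_dual smul = {f. Vector_Spaces.linear smul (*) f \<and> continuous_on UNIV f}"

definition seminorm :: "(complex \<Rightarrow> 'a::ab_group_add \<Rightarrow> 'a) \<Rightarrow> ('a \<Rightarrow> real) \<Rightarrow> bool" where
  "seminorm smul q \<longleftrightarrow>
    (\<forall>x. 0 \<le> q x) \<and> (\<forall>c x. q (smul c x) = cmod c * q x) \<and> (\<forall>x y. q (x + y) \<le> q x + q y)"

text \<open>The order in \<open>incseq\<close> is the pointwise order on real-valued functions.\<close>

definition increasing_fundamental_system ::
    "(complex \<Rightarrow> 'a::topological_ab_group_add \<Rightarrow> 'a) \<Rightarrow> (nat \<Rightarrow> 'a \<Rightarrow> real) \<Rightarrow> bool" where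
  "increasing_fundamental_system smul nrm \<longleftrightarrow>
    (\<forall>k. seminorm smul (nrm k) \<and> continuous_on UNIV (nrm k)) \<and> incseq nrm \<and>
    (\<forall>U. open U \<and> 0 \<in> U \<longrightarrow> (\<exists>k. \<exists>\<epsilon>>0. {x. nrm k x < \<epsilon>} \<subseteq> U))"

definition LB_infinity :: "(nat \<Rightarrow> 'a \<Rightarrow> real) \<Rightarrow> bool" where
  "LB_infinity nrm \<longleftrightarrow>
    (\<forall>\<rho> :: nat \<Rightarrow> real. (\<forall>m. 0 < \<rho> m) \<and> incseq \<rho> \<and> filterlim \<rho> at_top sequentially \<longrightarrow>
      (\<exists>p. \<forall>q. \<exists>n0\<ge>q. \<exists>C>0. \<forall>x. \<exists>m. q \<le> m \<and> m \<le> n0 \<and>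
        nrm q x powr (1 + \<rho> m) \<le> C * nrm m x * nrm p x powr \<rho> m))"

text \<open>Dirichlet series start at \<open>n = 1\<close>: the value \<open>a 0\<close> of a coefficient sequence \<open>a\<close> plays no role.
  A scalar Dirichlet series is the case where \<open>smul\<close> is multiplication of complex numbers.\<close>

definition dirichlet_converges ::
    "(complex \<Rightarrow> 'a::{topological_space, comm_monoid_add} \<Rightarrow> 'a) \<Rightarrow> (nat \<Rightarrow> 'a) \<Rightarrow> complex \<Rightarrow> bool" where
  "dirichlet_converges smul a s \<longleftrightarrow>
    summable (\<lambda>n. smul (1 / of_nat (Suc n) powr s) (a (Suc n)))"

definition abscissa_of_convergence ::
    "(complex \<Rightarrow> 'a::{topological_space, comm_monoid_add} \<Rightarrow> 'a) \<Rightarrow> (nat \<Rightarrow> 'a) \<Rightarrow> ereal" where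
  "abscissa_of_convergence smul a =
    Inf {ereal r | r. \<forall>s. r < Re s \<longrightarrow> dirichlet_converges smul a s}"

end

theory Submission
  imports Defs
begin

text \<open>A Dirichlet series has finite abscissa of convergence iff its coefficients grow at most
  polynomially, with one exponent \<open>k\<close> that serves all seminorms. Weakly finite abscissas mean
  polynomial growth of every \<open>x' (a n)\<close>; by Hahn--Banach and a gliding hump this amounts to
  polynomial growth in each seminorm, with an exponent depending on the seminorm. So the claim is that
  \<open>LB_infinity\<close> is what makes the exponents uniform. If it holds, apply it to the vectors \<open>a n\<close> with
  \<open>\<rho> m\<close> exceeding the \<open>m\<close>-th exponent. If it fails for \<open>\<rho>\<close>, its counterexamples yield for each
  \<open>k\<close> vectors of norm at most 1 in the \<open>k\<close>-th seminorm and at least \<open>n ^ (k + 1)\<close> in a later one, with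
  growth in the remaining seminorms controlled by \<open>\<rho>\<close>; interleaving them over all \<open>k\<close> gives a
  sequence without a uniform exponent.\<close>

subsection \<open>Hahn--Banach by minimal sublinear functionals\<close>

text \<open>Homogeneity is asked only as an inequality, which is easy to verify for infima; scaling
  back by \<open>1/t\<close> turns it into an equality.\<close>

definition sublinear :: "(complex \<Rightarrow> 'a::ab_group_add \<Rightarrow> 'a) \<Rightarrow> ('a \<Rightarrow> real) \<Rightarrow> bool" where
  "sublinear smul p \<longleftrightarrow> (\<forall>x y. p (x + y) \<le> p x + p y) \<and>
    (\<forall>t x. 0 \<le> t \<longrightarrow> p (smul (complex_of_real t) x) \<le> t * p x)"

lemma sublinearI:
  assumes "\<And>x y. p (x + y) \<le> p x + p y"
    and "\<And>t x. 0 \<le> t \<Longrightarrow> p (smul (complex_of_real t) x) \<le> t * p x"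
  shows "sublinear smul p"
  using assms by (auto simp: sublinear_def)

context
  fixes smul :: "complex \<Rightarrow> 'a::ab_group_add \<Rightarrow> 'a"
  assumes vs: "vector_space smul"
begin

interpretation vector_space smul by (fact vs)

lemma sublinear_add: "sublinear smul p \<Longrightarrow> p (x + y) \<le> p x + p y"
  by (auto simp: sublinear_def)

lemma sublinear_scale_le:
  "sublinear smul p \<Longrightarrow> 0 \<le> t \<Longrightarrow> p (smul (complex_of_real t) x) \<le> t * p x"
  by (auto simp: sublinear_def)

lemma sublinear_zero:
  assumes "sublinear smul p"
  shows "p 0 = 0"
  using sublinear_add[OF assms, of 0 0] sublinear_scale_le[OF assms, of 0 0] by simp

lemma sublinear_scale:
  assumes p: "sublinear smul p" and t: "0 \<le> t"
  shows "p (smul (complex_of_real t) x) = t * p x"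
proof (cases "t = 0")
  case True
  then show ?thesis using sublinear_zero[OF p] by simp
next
  case False
  with t have "t > 0" by simp
  have "p x = p (smul (complex_of_real (1/t)) (smul (complex_of_real t) x))"
    using False by (simp flip: of_real_mult)
  also have "\<dots> \<le> (1/t) * p (smul (complex_of_real t) x)"
    using t by (intro sublinear_scale_le[OF p]) simp
  finally have "t * p x \<le> p (smul (complex_of_real t) x)"
    using \<open>t > 0\<close> by (simp add: field_simps)
  with sublinear_scale_le[OF p t, of x] show ?thesis by simp
qed

lemma sublinear_minus_ge:
  assumes "sublinear smul p"
  shows "- p (- x) \<le> p x"
  using sublinear_add[OF assms, of x "- x"] sublinear_zero[OF assms] by simp

text \<open>The witness is the largest such \<open>p'\<close>. Hence a minimal sublinear functional is odd, and so linear.\<close>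

lemma sublinear_reduce:
  assumes p: "sublinear smul p"
  shows "\<exists>p'. sublinear smul p' \<and> (\<forall>x. p' x \<le> p x) \<and> p' (- y) \<le> - p y"
proof -
  \<comment> \<open>Any sublinear \<open>r\<close> below \<open>p\<close> with
    \<open>r (- y) \<le> - p y\<close> satisfies
    \<open>r x \<le> r (x + t y) + t * r (- y) \<le> g x t\<close> for all \<open>t \<ge> 0\<close>.
    This forces the infimum of \<open>g x\<close> as the candidate.\<close>
  define g where "g x t = p (x + smul (complex_of_real t) y) - t * p y" for x t
  define p' where "p' x = (INF t\<in>{0..}. g x t)" for x
  have lb: "- p (- x) \<le> g x t" if "0 \<le> t" for x t
  proof -
    have "t * p y = p (smul (complex_of_real t) y)" using sublinear_scale[OF p that] by simp
    also have "\<dots> \<le> p (x + smul (complex_of_real t) y) + p (- x)"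
      using sublinear_add[OF p, of "x + smul (complex_of_real t) y" "- x"] by simp
    finally show ?thesis by (simp add: g_def)
  qed
  have bdd: "bdd_below (g x ` {0..})" for x
    using lb[of _ x] by (intro bdd_belowI2[where m = "- p (- x)"]) auto
  have le: "p' x \<le> g x t" if "0 \<le> t" for x t
    unfolding p'_def using that by (intro cINF_lower bdd) auto
  have ge: "c \<le> p' x" if "\<And>t. 0 \<le> t \<Longrightarrow> c \<le> g x t" for c x
    unfolding p'_def using that by (intro cINF_greatest) auto
  have "sublinear smul p'"
  proof (rule sublinearI)
    fix x z
    have *: "p' (x + z) \<le> g x t + g z u" if "0 \<le> t" "0 \<le> u" for t u
    proof -
      have "p' (x + z) \<le> g (x + z) (t + u)" using that by (intro le) simp
      also have "\<dots> \<le> g x t + g z u"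
        using sublinear_add[OF p, of "x + smul (complex_of_real t) y" "z + smul (complex_of_real u) y"]
        by (simp add: g_def scale_left_distrib algebra_simps)
      finally show ?thesis .
    qed
    have "p' (x + z) - g z u \<le> p' x" if "0 \<le> u" for u
      using *[OF _ that] by (intro ge) (simp add: algebra_simps)
    then have "p' (x + z) - p' x \<le> p' z"
      by (intro ge) (simp add: algebra_simps)
    then show "p' (x + z) \<le> p' x + p' z" by simp
  next
    fix c x assume c: "(0::real) \<le> c"
    show "p' (smul (complex_of_real c) x) \<le> c * p' x"
    proof (cases "c = 0")
      case True
      then show ?thesis using le[of 0 0] sublinear_zero[OF p] by (simp add: g_def)
    next
      case False
      with c have c0: "c > 0" by simp
      have "p' (smul (complex_of_real c) x) / c \<le> p' x"
      proof (rule ge)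
        fix t assume t: "(0::real) \<le> t"
        have "p' (smul (complex_of_real c) x) \<le> g (smul (complex_of_real c) x) (c * t)"
          using t c by (intro le) simp
        also have "\<dots> = c * g x t"
          using sublinear_scale[OF p c, of "x + smul (complex_of_real t) y"]
          by (simp add: g_def scale_right_distrib algebra_simps)
        finally show "p' (smul (complex_of_real c) x) / c \<le> g x t"
          using c0 by (simp add: field_simps)
      qed
      then show ?thesis using c0 by (simp add: field_simps)
    qed
  qed
  moreover have "p' x \<le> p x" for x using le[of 0 x] by (simp add: g_def)
  moreover have "p' (- y) \<le> - p y"
    using le[of 1 "- y"] sublinear_zero[OF p] by (simp add: g_def)
  ultimately show ?thesis by blast
qed

text \<open>Zorn's lemma for the reversed pointwise order. A nonempty chain is bounded by its
  pointwise infimum, which is finite because each member satisfies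
  \<open>- q (- x) \<le> p x\<close>. The infimum is subadditive because the smaller of two members
  of the chain can stand in for both.\<close>

lemma minimal_sublinear_exists:
  assumes q: "sublinear smul q"
  shows "\<exists>p. sublinear smul p \<and> (\<forall>x. p x \<le> q x) \<and>
    (\<forall>p'. sublinear smul p' \<and> (\<forall>x. p' x \<le> p x) \<longrightarrow> p' = p)"
proof -
  define A where "A = {p. sublinear smul p \<and> (\<forall>x. p x \<le> q x)}"
  define P where "P = (\<lambda>p p' :: 'a \<Rightarrow> real. \<forall>x. p' x \<le> p x)"
  have "\<exists>m\<in>A. \<forall>a\<in>A. P m a \<longrightarrow> a = m"
  proof (rule predicate_Zorn)
    show "partial_order_on A (relation_of P A)"
      by (rule partial_order_on_relation_ofI)
        (auto simp: P_def fun_eq_iff intro: order_trans antisym)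
  next
    fix C assume "C \<in> Chains (relation_of P A)"
    then have CA: "C \<subseteq> A" and chain: "\<And>p p'. p \<in> C \<Longrightarrow> p' \<in> C \<Longrightarrow> P p p' \<or> P p' p"
      by (auto simp: Chains_def relation_of_def)
    show "\<exists>u\<in>A. \<forall>a\<in>C. P a u"
    proof (cases "C = {}")
      case True
      then show ?thesis using q by (auto simp: A_def)
    next
      case False
      define u where "u x = (INF p\<in>C. p x)" for x
      have sub: "sublinear smul p" and leq: "p x \<le> q x" if "p \<in> C" for p x
        using that CA by (auto simp: A_def)
      have "- q (- x) \<le> p x" if "p \<in> C" for p x
        using sublinear_minus_ge[OF sub[OF that], of x] leq[OF that, of "- x"] by linarith
      then have bdd: "bdd_below ((\<lambda>p. p x) ` C)" for x
        by (intro bdd_belowI2[where m = "- q (- x)"]) auto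
      have le: "u x \<le> p x" if "p \<in> C" for p x
        unfolding u_def using that by (intro cINF_lower bdd)
      have ge: "c \<le> u x" if "\<And>p. p \<in> C \<Longrightarrow> c \<le> p x" for c x
        unfolding u_def using that False by (intro cINF_greatest) auto
      have "sublinear smul u"
      proof (rule sublinearI)
        fix x z
        have *: "u (x + z) \<le> p x + p' z" if p: "p \<in> C" and p': "p' \<in> C" for p p'
        proof -
          obtain r where r: "r \<in> C" "\<forall>x. r x \<le> p x" "\<forall>x. r x \<le> p' x"
            using chain[OF p p'] p p' unfolding P_def by blast
          have "u (x + z) \<le> r (x + z)" by (rule le[OF r(1)])
          also have "\<dots> \<le> r x + r z" by (rule sublinear_add[OF sub[OF r(1)]])
          also have "\<dots> \<le> p x + p' z" using r by (intro add_mono) auto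
          finally show ?thesis .
        qed
        have "u (x + z) - p' z \<le> u x" if "p' \<in> C" for p'
          using *[OF _ that] by (intro ge) (simp add: algebra_simps)
        then have "u (x + z) - u x \<le> u z"
          by (intro ge) (simp add: algebra_simps)
        then show "u (x + z) \<le> u x + u z" by simp
      next
        fix c x assume c: "(0::real) \<le> c"
        have *: "u (smul (complex_of_real c) x) \<le> c * p x" if "p \<in> C" for p
          using le[OF that] sublinear_scale[OF sub[OF that] c] by metis
        show "u (smul (complex_of_real c) x) \<le> c * u x"
        proof (cases "c = 0")
          case True
          then show ?thesis using * False by auto
        next
          case False
          with c have c0: "c > 0" by simp
          have "u (smul (complex_of_real c) x) / c \<le> u x"
            using * c0 by (intro ge) (simp add: field_simps)
          then show ?thesis using c0 by (simp add: field_simps)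
        qed
      qed
      moreover have "u x \<le> q x" for x
        using False le leq by (meson all_not_in_conv order_trans)
      ultimately have "u \<in> A" by (auto simp: A_def)
      then show ?thesis using le by (auto simp: P_def)
    qed
  qed
  then obtain p where p: "p \<in> A" "\<And>a. a \<in> A \<Longrightarrow> P p a \<Longrightarrow> a = p" by blast
  have "p' = p" if "sublinear smul p'" "\<forall>x. p' x \<le> p x" for p'
  proof (rule p(2))
    show "p' \<in> A" using that p(1) unfolding A_def by (blast intro: order_trans)
    show "P p p'" using that(2) by (simp add: P_def)
  qed
  with p(1) show ?thesis by (auto simp: A_def)
qed

text \<open>Reducing at \<open>x0\<close> first ensures that every odd functional below
  \<open>q'\<close> is at least \<open>q x0\<close> at \<open>x0\<close>. A minimal \<open>f\<close>
  below \<open>q'\<close> is unchanged by a further reduction at any \<open>y\<close>, so it is odd,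
  and an odd sublinear functional is real linear.\<close>

lemma Hahn_Banach_sublinear:
  assumes q: "sublinear smul q"
  shows "\<exists>f. (\<forall>x y. f (x + y) = f x + f y) \<and> (\<forall>t x. f (smul (complex_of_real t) x) = t * f x) \<and>
    (\<forall>x. f x \<le> q x) \<and> f x0 = q x0"
proof -
  obtain q' where q': "sublinear smul q'" "\<And>x. q' x \<le> q x" "q' (- x0) \<le> - q x0"
    using sublinear_reduce[OF q] by blast
  obtain f where f: "sublinear smul f" and fq: "\<And>x. f x \<le> q' x"
    and min: "\<And>p'. sublinear smul p' \<Longrightarrow> (\<And>x. p' x \<le> f x) \<Longrightarrow> p' = f"
    using minimal_sublinear_exists[OF q'(1)] by blast
  have "f (- y) \<le> - f y" for y
    using sublinear_reduce[OF f, of y] min by blast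
  with sublinear_minus_ge[OF f] have neg: "f (- y) = - f y" for y
    by (metis add.inverse_inverse neg_le_iff_le order_antisym)
  have "f (x + y) = f x + f y" for x y
    using sublinear_add[OF f, of x y] sublinear_add[OF f, of "x + y" "- y"] neg[of y] by simp
  moreover have "f (smul (complex_of_real t) x) = t * f x" for t x
  proof (cases "0 \<le> t")
    case True
    then show ?thesis by (rule sublinear_scale[OF f])
  next
    case False
    then have "f (smul (complex_of_real (- t)) x) = (- t) * f x"
      by (intro sublinear_scale[OF f]) simp
    then show ?thesis using neg by simp
  qed
  moreover have "f x \<le> q x" for x using fq q'(2) order_trans by blast
  moreover have "f x0 = q x0"
    using fq[of "- x0"] q'(3) neg[of x0] \<open>f x0 \<le> q x0\<close> by linarith
  ultimately show ?thesis by blast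
qed

text \<open>The real functional \<open>u\<close> is complexified to the \<open>f\<close> with real
  part \<open>u\<close>. Since \<open>q\<close> is invariant under unimodular factors, rotating
  \<open>x\<close> until \<open>f x\<close> is real and nonnegative turns \<open>u \<le> q\<close>
  into a bound on \<open>cmod (f x)\<close>.\<close>

lemma Hahn_Banach_seminorm:
  assumes q: "seminorm smul q"
  shows "\<exists>f. Vector_Spaces.linear smul (*) f \<and> (\<forall>x. cmod (f x) \<le> q x) \<and> cmod (f x0) = q x0"
proof -
  have q0: "0 \<le> q x" and qs: "q (smul c x) = cmod c * q x" and qa: "q (x + y) \<le> q x + q y" for c x y
    using q by (auto simp: seminorm_def)
  have "sublinear smul q"
    by (rule sublinearI) (auto simp: qs qa)
  then obtain u where add: "\<And>x y. u (x + y) = u x + u y"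
    and sc: "\<And>t x. u (smul (complex_of_real t) x) = t * u x"
    and le: "\<And>x. u x \<le> q x" and x0: "u x0 = q x0"
    using Hahn_Banach_sublinear by meson
  define f where "f x = Complex (u x) (- u (smul \<i> x))" for x
  have f_add: "f (x + y) = f x + f y" for x y
    by (simp add: f_def add scale_right_distrib complex_eq_iff)
  have f_scale: "f (smul c x) = c * f x" for c x
  proof -
    have "smul c x = smul (complex_of_real (Re c)) x + smul (complex_of_real (Im c)) (smul \<i> x)"
      by (metis complex_eq mult.commute scale_left_distrib scale_scale)
    then have u1: "u (smul c x) = Re c * u x + Im c * u (smul \<i> x)"
      by (simp only: add sc)
    have "smul \<i> (smul c x) = smul (complex_of_real (- Im c)) x + smul (complex_of_real (Re c)) (smul \<i> x)"
      unfolding scale_scale scale_left_distrib[symmetric]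
      by (rule arg_cong[where f = "\<lambda>c. smul c x"]) (simp add: complex_eq_iff)
    then have u2: "u (smul \<i> (smul c x)) = - Im c * u x + Re c * u (smul \<i> x)"
      by (simp only: add sc)
    show ?thesis
      unfolding f_def u1 u2 by (simp add: complex_eq_iff)
  qed
  have f_le: "cmod (f x) \<le> q x" for x
  proof (cases "f x = 0")
    case False
    define c where "c = cnj (sgn (f x))"
    have c: "cmod c = 1" using False by (simp add: c_def norm_sgn)
    have "c * f x = cmod (f x)"
      using False by (simp add: c_def sgn_eq mult.commute[of _ "f x"] power2_eq_square
          flip: complex_norm_square)
    then have "cmod (f x) = Re (f (smul c x))" by (simp add: f_scale)
    also have "\<dots> = u (smul c x)" by (simp add: f_def)
    also have "\<dots> \<le> q (smul c x)" by (rule le)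
    finally show ?thesis by (simp add: qs c)
  qed (simp add: q0)
  have "q x0 = Re (f x0)" by (simp add: f_def x0)
  also have "\<dots> \<le> cmod (f x0)" by (rule complex_Re_le_cmod)
  finally have "cmod (f x0) = q x0" using f_le[of x0] by simp
  moreover have "Vector_Spaces.linear smul (*) f"
    by (unfold_locales) (auto simp: f_add f_scale algebra_simps)
  ultimately show ?thesis using f_le by blast
qed

end

subsection \<open>Weak and seminormwise polynomial growth\<close>

text \<open>The difference of \<open>u + v\<close> and \<open>u - v\<close> is \<open>2 * v\<close>,
  so they cannot both be shorter than \<open>v\<close>.\<close>

lemma sign_choice: "cmod v \<le> cmod (u + v) \<or> cmod v \<le> cmod (u - v)"
  using norm_triangle_ineq4[of "u + v" "u - v"] by (simp flip: mult_2) linarith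

text \<open>One functional dominated by \<open>2 * q\<close> detects the size of all
  \<open>x i\<close> at once, at the price of a factor \<open>2 * 3 ^ i\<close>. It is a signed
  series of the terms \<open>g i / 3 ^ i\<close>, where \<open>g i\<close> is a Hahn--Banach
  functional norming \<open>x i\<close>.\<close>

lemma gliding_hump:
  fixes smul :: "complex \<Rightarrow> 'a::ab_group_add \<Rightarrow> 'a" and x :: "nat \<Rightarrow> 'a"
  assumes vs: "vector_space smul" and q: "seminorm smul q"
  shows "\<exists>f. Vector_Spaces.linear smul (*) f \<and> (\<forall>y. cmod (f y) \<le> 2 * q y) \<and>
    (\<forall>i. q (x i) \<le> 2 * 3 ^ i * cmod (f (x i)))"
proof -
  interpret vector_space smul by (fact vs)
  have q0: "0 \<le> q y" for y using q by (auto simp: seminorm_def)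
  have "\<exists>f. Vector_Spaces.linear smul (*) f \<and> (\<forall>y. cmod (f y) \<le> q y) \<and> cmod (f (x i)) = q (x i)" for i
    by (rule Hahn_Banach_seminorm[OF vs q])
  then obtain g where lin: "\<And>i. Vector_Spaces.linear smul (*) (g i)"
    and g_le: "\<And>i y. cmod (g i y) \<le> q y" and g_eq: "\<And>i. cmod (g i (x i)) = q (x i)"
    by metis
  have g_add: "g i (y + z) = g i y + g i z" and g_scale: "g i (smul c y) = c * g i y" for i y z c
    using lin[of i] by (simp_all add: Vector_Spaces.linear_iff)
  \<comment> \<open>Signs are chosen so that the \<open>i\<close>-th term is not cancelled at \<open>x i\<close> by the earlier ones; all later
    terms together have at most half its size.\<close>
  define F where "F = rec_nat (\<lambda>_. 0) (\<lambda>i h.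
    if cmod (g i (x i) / 3 ^ i) \<le> cmod (h (x i) + g i (x i) / 3 ^ i)
    then (\<lambda>y. h y + g i y / 3 ^ i) else (\<lambda>y. h y - g i y / 3 ^ i))"
  have F0: "F 0 = (\<lambda>_. 0)" by (simp add: F_def)
  have FSuc: "F (Suc i) = (if cmod (g i (x i) / 3 ^ i) \<le> cmod (F i (x i) + g i (x i) / 3 ^ i)
    then (\<lambda>y. F i y + g i y / 3 ^ i) else (\<lambda>y. F i y - g i y / 3 ^ i))" for i
    by (simp add: F_def)
  define D where "D i y = F (Suc i) y - F i y" for i y
  have D_add: "D i (y + z) = D i y + D i z" and D_scale: "D i (smul c y) = c * D i y" for i y z c
    by (simp_all add: D_def FSuc g_add g_scale field_simps)
  have D_le: "cmod (D i y) \<le> q y * (1/3) ^ i" for i y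
    using g_le[of i y] by (simp add: D_def FSuc norm_divide norm_power divide_right_mono power_one_over)
  have F_sum: "F n y = (\<Sum>i<n. D i y)" for n y
    unfolding D_def by (simp add: sum_lessThan_telescope[of "\<lambda>i. F i y"] F0)
  have geo: "(\<lambda>i. q y * (1/3) ^ (i + n)) sums (q y * (1/3) ^ n * (3/2))" for y n
    using sums_mult[OF geometric_sums[of "1/3::real"], of "q y * (1/3)^n"]
    by (simp add: power_add mult_ac)
  have sD: "summable (\<lambda>i. D (i + n) y)" for n y
    by (rule summable_comparison_test'[OF sums_summable[OF geo]]) (rule D_le)
  have sD0: "summable (\<lambda>i. D i y)" for y using sD[where n = 0] by simp
  have tail: "cmod (\<Sum>i. D (i + n) y) \<le> q y * (1/3) ^ n * (3/2)" for n y
  proof -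
    have "cmod (\<Sum>i. D (i + n) y) \<le> (\<Sum>i. q y * (1/3) ^ (i + n))"
      by (rule norm_suminf_le[OF D_le sums_summable[OF geo]])
    with sums_unique[OF geo] show ?thesis by metis
  qed
  define f where "f y = (\<Sum>i. D i y)" for y
  have "Vector_Spaces.linear smul (*) f"
    by unfold_locales
      (auto simp: f_def D_add D_scale suminf_add[OF sD0 sD0] suminf_mult[OF sD0] algebra_simps)
  moreover have "cmod (f y) \<le> 2 * q y" for y
    using tail[where n = 0 and y = y] q0[of y] by (simp add: f_def)
  moreover have "q (x i) \<le> 2 * 3 ^ i * cmod (f (x i))" for i
  proof -
    have "q (x i) / 3 ^ i = cmod (g i (x i) / 3 ^ i)"
      by (simp add: g_eq norm_divide norm_power)
    also have "\<dots> \<le> cmod (F (Suc i) (x i))"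
      using sign_choice[of "g i (x i) / 3 ^ i" "F i (x i)"] by (auto simp: FSuc)
    also have "F (Suc i) (x i) = f (x i) - (\<Sum>l. D (l + Suc i) (x i))"
      unfolding f_def F_sum by (subst suminf_split_initial_segment[OF sD0, of "x i" "Suc i"]) simp
    also have "cmod \<dots> \<le> cmod (f (x i)) + cmod (\<Sum>l. D (l + Suc i) (x i))"
      by (rule norm_triangle_ineq4)
    \<comment> \<open>Here \<open>(1/3) ^ Suc i * (3/2)\<close> is half of \<open>(1/3) ^ i\<close>,
      so half of \<open>q (x i) / 3 ^ i\<close> is left for \<open>f (x i)\<close>.\<close>
    also have "\<dots> \<le> cmod (f (x i)) + q (x i) * (1/3) ^ Suc i * (3/2)"
      by (intro add_left_mono tail)
    finally show ?thesis by (simp add: field_simps power_one_over)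
  qed
  ultimately show ?thesis by blast
qed

text \<open>If \<open>q (b n)\<close> exceeds every polynomial, the gliding hump along suitable
  indices gives one functional that does so too. The bound \<open>2 * q\<close> in
  \<open>weak\<close> is the one that \<open>gliding_hump\<close> delivers; for continuous
  \<open>q\<close> it makes the functional continuous.\<close>

lemma weakly_polynomial_growth_imp_seminorm:
  fixes smul :: "complex \<Rightarrow> 'a::ab_group_add \<Rightarrow> 'a" and b :: "nat \<Rightarrow> 'a"
  assumes vs: "vector_space smul" and q: "seminorm smul q"
    and weak: "\<And>f. Vector_Spaces.linear smul (*) f \<Longrightarrow> (\<forall>y. cmod (f y) \<le> 2 * q y) \<Longrightarrow>
      \<exists>(k::nat) M. \<forall>n. cmod (f (b n)) \<le> M * real (Suc n) ^ k"
  shows "\<exists>(k::nat) M. \<forall>n. q (b n) \<le> M * real (Suc n) ^ k"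
proof (rule ccontr)
  assume "\<not> ?thesis"
  \<comment> \<open>Of \<open>6 ^ i = 3 ^ i * 2 ^ i\<close>, the factor \<open>3 ^ i\<close> pays
    for the loss in \<open>gliding_hump\<close> and \<open>2 ^ i\<close> outgrows the constant
    \<open>2 * M\<close>. This works even if the indices \<open>\<nu> i\<close> repeat.\<close>
  then have "\<forall>i. \<exists>n. 6 ^ i * real (Suc n) ^ i < q (b n)" by (meson not_less)
  then obtain \<nu> where \<nu>: "\<And>i. 6 ^ i * real (Suc (\<nu> i)) ^ i < q (b (\<nu> i))" by metis
  obtain f where f: "Vector_Spaces.linear smul (*) f" "\<forall>y. cmod (f y) \<le> 2 * q y"
    and big: "\<And>i. q (b (\<nu> i)) \<le> 2 * 3 ^ i * cmod (f (b (\<nu> i)))"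
    using gliding_hump[OF vs q, of "\<lambda>i. b (\<nu> i)"] by blast
  obtain k :: nat and M where M: "\<And>n. cmod (f (b n)) \<le> M * real (Suc n) ^ k"
    using weak[OF f] by blast
  have "M * real (Suc 0) ^ k \<ge> 0" using M[of 0] norm_ge_zero order_trans by blast
  then have M0: "M \<ge> 0" by simp
  obtain l where l: "2 * M < 2 ^ l" using real_arch_pow[of 2 "2 * M"] by auto
  define i where "i = l + k"
  have "6 ^ i * real (Suc (\<nu> i)) ^ i < 2 * 3 ^ i * (M * real (Suc (\<nu> i)) ^ k)"
    by (rule less_le_trans[OF \<nu> order_trans[OF big]]) (intro mult_left_mono M, simp)
  also have "\<dots> \<le> 2 * 3 ^ i * (M * real (Suc (\<nu> i)) ^ i)"
    using M0 by (intro mult_left_mono power_increasing) (auto simp: i_def)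
  also have "\<dots> = 3 ^ i * (2 * M) * real (Suc (\<nu> i)) ^ i" by simp
  finally have "(6::real) ^ i < 3 ^ i * (2 * M)"
    by (simp add: mult_less_cancel_right)
  also have "(6::real) ^ i = 3 ^ i * 2 ^ i" by (simp flip: power_mult_distrib)
  finally have "2 ^ i < 2 * M" by simp
  moreover have "(2::real) ^ l \<le> 2 ^ i" by (simp add: i_def)
  ultimately show False using l by simp
qed

subsection \<open>Uniform growth exponents and \<open>LB_infinity\<close>\<close>

text \<open>Write \<open>w = n + 1\<close> and let \<open>K j\<close> be an exponent for
  \<open>nrm j\<close>. If \<open>\<rho> m \<ge> K m\<close>, the right-hand side of the condition
  is at most a constant times \<open>w\<close> to the power \<open>\<rho> m * (1 + K p)\<close>.
  Taking the root of order \<open>1 + \<rho> m\<close> leaves the exponent \<open>1 + K p\<close>,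
  and \<open>p\<close> is chosen before \<open>q\<close>.\<close>

lemma LB_infinity_uniform_growth:
  fixes nrm :: "nat \<Rightarrow> 'a \<Rightarrow> real" and b :: "nat \<Rightarrow> 'a"
  assumes LB: "LB_infinity nrm" and nn: "\<And>k x. 0 \<le> nrm k x"
    and growth: "\<And>j. \<exists>(k::nat) M. \<forall>n. nrm j (b n) \<le> M * real (Suc n) ^ k"
  shows "\<exists>k::nat. \<forall>j. \<exists>M. \<forall>n. nrm j (b n) \<le> M * real (Suc n) ^ k"
proof -
  have "\<exists>(k::nat) M. 0 \<le> M \<and> (\<forall>n. nrm j (b n) \<le> M * real (Suc n) ^ k)" for j
  proof -
    obtain k :: nat and M where M: "\<forall>n. nrm j (b n) \<le> M * real (Suc n) ^ k"
      using growth by blast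
    have "0 \<le> M * real (Suc 0) ^ k" using M nn order_trans by blast
    then show ?thesis using M by auto
  qed
  then obtain K :: "nat \<Rightarrow> nat" and M where M0: "\<And>j. 0 \<le> M j"
    and M: "\<And>j n. nrm j (b n) \<le> M j * real (Suc n) ^ K j"
    by metis
  \<comment> \<open>The partial sums make \<open>\<rho>\<close> increasing and at least
    \<open>K\<close>; the summand \<open>Suc m\<close> makes it positive and divergent.\<close>
  define \<rho> where "\<rho> m = real (Suc m + (\<Sum>i\<le>m. K i))" for m
  have \<rho>_pos: "0 < \<rho> m" for m unfolding \<rho>_def of_nat_0_less_iff by simp
  have \<rho>_K: "real (K m) \<le> \<rho> m" for m
    unfolding \<rho>_def of_nat_le_iff using member_le_sum[of m "{..m}" K] by simp
  have "incseq \<rho>" by (rule incseq_SucI) (simp add: \<rho>_def)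
  moreover have "filterlim \<rho> at_top sequentially"
    by (rule filterlim_at_top_mono[OF filterlim_real_sequentially])
      (simp add: \<rho>_def sum_nonneg add_nonneg_nonneg)
  ultimately obtain p where p: "\<And>q. \<exists>n0\<ge>q. \<exists>C>0. \<forall>x. \<exists>m. q \<le> m \<and> m \<le> n0 \<and>
        nrm q x powr (1 + \<rho> m) \<le> C * nrm m x * nrm p x powr \<rho> m"
    using LB[unfolded LB_infinity_def, rule_format, of \<rho>] \<rho>_pos by auto
  have "\<exists>L. \<forall>n. nrm q (b n) \<le> L * real (Suc n) ^ (1 + K p)" for q
  proof -
    obtain n0 C where C: "C > 0" and LBq: "\<And>x. \<exists>m. m \<le> n0 \<and>
        nrm q x powr (1 + \<rho> m) \<le> C * nrm m x * nrm p x powr \<rho> m"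
      using p[of q] by blast
    \<comment> \<open>The added 1 gives \<open>L m \<ge> 1\<close>, so that
      \<open>L m \<le> L m powr (1 + \<rho> m)\<close>. The index \<open>m\<close> depends on
      \<open>n\<close>, and the sum over all \<open>m \<le> n0\<close> absorbs this.\<close>
    define L where "L m = 1 + C * M m * M p powr \<rho> m" for m
    have L1: "1 \<le> L m" for m using C M0 by (simp add: L_def)
    have "nrm q (b n) \<le> (\<Sum>m\<le>n0. L m) * real (Suc n) ^ (1 + K p)" for n
    proof -
      define w where "w = real (Suc n)"
      have w: "1 \<le> w" by (simp add: w_def)
      obtain m where m: "m \<le> n0" "nrm q (b n) powr (1 + \<rho> m) \<le> C * nrm m (b n) * nrm p (b n) powr \<rho> m"
        using LBq by blast
      note m(2)
      also have "\<dots> \<le> C * (M m * w powr \<rho> m) * (M p * w ^ K p) powr \<rho> m"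
      proof (intro mult_mono powr_mono2)
        have "nrm m (b n) \<le> M m * w ^ K m" using M by (simp add: w_def)
        also have "w ^ K m = w powr real (K m)" using w by (simp add: powr_realpow)
        also have "M m * \<dots> \<le> M m * w powr \<rho> m"
          using w M0 \<rho>_K by (intro mult_left_mono powr_mono) auto
        finally show "nrm m (b n) \<le> M m * w powr \<rho> m" .
        show "nrm p (b n) \<le> M p * w ^ K p" using M by (simp add: w_def)
      qed (use C nn M0 \<rho>_pos[of m] w in \<open>auto intro: less_imp_le\<close>)
      also have "\<dots> = (C * M m * M p powr \<rho> m) * (w powr \<rho> m * (w ^ K p) powr \<rho> m)"
        using w M0 by (simp add: powr_mult mult_ac)
      also have "\<dots> \<le> L m * (w ^ (1 + K p)) powr \<rho> m"
        using w C M0[of m] by (intro mult_mono) (auto simp: L_def powr_mult)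
      also have "\<dots> \<le> L m powr (1 + \<rho> m) * (w ^ (1 + K p)) powr (1 + \<rho> m)"
      proof (intro mult_mono)
        show "L m \<le> L m powr (1 + \<rho> m)"
          using powr_mono[of 1 "1 + \<rho> m" "L m"] L1[of m] \<rho>_pos[of m] by simp
        show "(w ^ (1 + K p)) powr \<rho> m \<le> (w ^ (1 + K p)) powr (1 + \<rho> m)"
          using w by (intro powr_mono one_le_power) auto
      qed (use w L1[of m] in auto)
      also have "\<dots> = (L m * w ^ (1 + K p)) powr (1 + \<rho> m)"
        using w L1[of m] by (simp add: powr_mult)
      finally have "nrm q (b n) \<le> L m * w ^ (1 + K p)"
        using powr_less_mono2[of "1 + \<rho> m" "L m * w ^ (1 + K p)" "nrm q (b n)"] w L1[of m] \<rho>_pos[of m]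
        by (intro leI notI) (simp add: mult_nonneg_nonneg)
      also have "L m \<le> (\<Sum>m\<le>n0. L m)"
        using m(1) L1 by (intro member_le_sum) (auto intro: order_trans[OF zero_le_one])
      finally show ?thesis using w by (simp add: w_def mult_right_mono)
    qed
    then show ?thesis by blast
  qed
  then show ?thesis by blast
qed

text \<open>Normalise a counterexample \<open>x\<close> to \<open>nrm k a = 1\<close>, so that
  \<open>nrm q a\<close> is the quotient \<open>t\<close>, and place \<open>t\<close> between
  consecutive powers of exponent \<open>k + 1\<close>. The failed inequalities then read
  \<open>nrm m a \<le> t powr (1 + \<rho> m)\<close>. If \<open>nrm k x = 0\<close>, the vector can
  be scaled freely instead.\<close>

lemma not_LB_infinity_peak:
  fixes smul :: "complex \<Rightarrow> 'a::ab_group_add \<Rightarrow> 'a" and nrm :: "nat \<Rightarrow> 'a \<Rightarrow> real"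
  assumes sn: "\<And>k. seminorm smul (nrm k)" and inc: "incseq nrm"
    and \<rho>_pos: "\<And>m. 0 < \<rho> m"
    and fails: "\<And>n0 C. q \<le> n0 \<Longrightarrow> 0 < C \<Longrightarrow> \<exists>x. \<forall>m. q \<le> m \<longrightarrow> m \<le> n0 \<longrightarrow>
        C * nrm m x * nrm k x powr \<rho> m < nrm q x powr (1 + \<rho> m)"
  shows "\<exists>(n::nat) a. B \<le> n \<and> nrm k a \<le> 1 \<and> real (Suc n) ^ Suc k \<le> nrm q a \<and>
    (\<forall>m. q \<le> m \<longrightarrow> m \<le> N \<longrightarrow> nrm m a \<le> real (n + 2) powr (real (k + 2) * (1 + \<rho> m)))"
proof -
  have nn: "0 \<le> nrm j x" and sc: "nrm j (smul c x) = cmod c * nrm j x" for j x c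
    using sn[of j] by (auto simp: seminorm_def)
  have mono: "nrm i x \<le> nrm j x" if "i \<le> j" for i j x
    using incseqD[OF inc that] by (simp add: le_fun_def)
  \<comment> \<open>The failed inequality at \<open>m = q\<close> gives
    \<open>C < t powr \<rho> q\<close>, so this \<open>C\<close> forces \<open>t\<close> above
    \<open>(B + 1) ^ (k + 1)\<close> and hence \<open>n \<ge> B\<close>. Below,
    \<open>max N q\<close> keeps \<open>m = q\<close> in range.\<close>
  define C where "C = (real (Suc B) ^ Suc k) powr \<rho> q"
  have C1: "1 \<le> C" unfolding C_def
    by (intro ge_one_powr_ge_zero one_le_power less_imp_le[OF \<rho>_pos]) simp
  obtain x where x: "\<And>m. q \<le> m \<Longrightarrow> m \<le> max N q \<Longrightarrow>
      C * nrm m x * nrm k x powr \<rho> m < nrm q x powr (1 + \<rho> m)"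
    using fails[of "max N q" C] C1 by auto
  define X P where "X = nrm q x" and "P = nrm k x"
  have xq: "C * X * P powr \<rho> q < X powr (1 + \<rho> q)"
    using x[of q] by (simp add: X_def P_def)
  then have "X \<noteq> 0" by auto
  with nn have X: "X > 0" by (metis X_def less_eq_real_def)
  show ?thesis
  proof (cases "P = 0")
    case True
    \<comment> \<open>With \<open>n\<close> above \<open>nrm N x / X\<close>, the other seminorms of
      the rescaled vector cost one more factor \<open>n + 2\<close>. This is why the exponent in the
      conclusion has \<open>k + 2\<close> instead of \<open>k + 1\<close>.\<close>
    obtain n1 :: nat where n1: "nrm N x / X \<le> n1" using real_arch_simple by blast
    define n where "n = max B n1"
    define a where "a = smul (complex_of_real (real (Suc n) ^ Suc k / X)) x"
    have a: "nrm j a = real (Suc n) ^ Suc k / X * nrm j x" for j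
      unfolding a_def sc using X by (simp add: norm_divide norm_mult norm_power del: power_Suc of_nat_Suc)
    have "nrm m a \<le> real (n + 2) powr (real (k + 2) * (1 + \<rho> m))" if "m \<le> N" for m
    proof -
      have "nrm m a = real (Suc n) ^ Suc k * (nrm m x / X)" by (simp add: a)
      also have "\<dots> \<le> real (n + 2) ^ Suc k * real (n + 2)"
      proof (intro mult_mono power_mono)
        have "nrm m x / X \<le> nrm N x / X" using X mono[OF that] by (simp add: divide_right_mono)
        also have "\<dots> \<le> real (n + 2)" using n1 by (simp add: n_def)
        finally show "nrm m x / X \<le> real (n + 2)" .
      qed (use X nn in auto)
      also have "\<dots> = real (n + 2) powr real (k + 2)" by (subst powr_realpow) auto
      also have "\<dots> \<le> real (n + 2) powr (real (k + 2) * (1 + \<rho> m))"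
        using \<rho>_pos[of m] by (intro powr_mono) (auto simp: algebra_simps)
      finally show ?thesis .
    qed
    moreover have "nrm k a \<le> 1" using True by (simp add: a P_def[symmetric])
    moreover have "real (Suc n) ^ Suc k \<le> nrm q a" using X by (simp add: a X_def[symmetric])
    ultimately show ?thesis by (intro exI[of _ n] exI[of _ a]) (auto simp: n_def)
  next
    case False
    with nn have P: "P > 0" by (metis P_def less_eq_real_def)
    define t where "t = X / P"
    have t0: "t > 0" using X P by (simp add: t_def)
    have Bt: "real (Suc B) ^ Suc k < t"
    proof (rule ccontr)
      assume "\<not> ?thesis"
      then have "t powr \<rho> q \<le> C"
        unfolding C_def using t0 \<rho>_pos[of q] by (intro powr_mono2) auto
      then have "X powr \<rho> q \<le> C * P powr \<rho> q"
        using X P by (simp add: t_def powr_divide field_simps)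
      then have "X * X powr \<rho> q \<le> X * (C * P powr \<rho> q)" using X by (intro mult_left_mono) auto
      then show False using xq X by (simp add: powr_add mult_ac)
    qed
    have "\<exists>n::nat. t < real (n + 2) ^ Suc k"
    proof -
      obtain n :: nat where "t < n" using reals_Archimedean2 by blast
      also have "real n \<le> real (n + 2) ^ 1" by simp
      also have "\<dots> \<le> real (n + 2) ^ Suc k" by (intro power_increasing) auto
      finally show ?thesis by blast
    qed
    \<comment> \<open>For \<open>n > 0\<close>, leastness gives the lower bound
      \<open>(n + 1) ^ (k + 1) \<le> t\<close>; for \<open>n = 0\<close> that bound is 1, which
      \<open>t\<close> exceeds by \<open>Bt\<close>.\<close>
    then obtain n :: nat where n: "t < real (n + 2) ^ Suc k"
      and least: "\<And>i. i < n \<Longrightarrow> real (i + 2) ^ Suc k \<le> t"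
      using exists_least_iff[of "\<lambda>n::nat. t < real (n + 2) ^ Suc k"] by (auto simp: not_less)
    have nt: "real (Suc n) ^ Suc k \<le> t"
    proof (cases n)
      case 0
      have "1 \<le> real (Suc B) ^ Suc k" by (intro one_le_power) simp
      with 0 Bt show ?thesis by simp
    next
      case (Suc i)
      then show ?thesis using least[of i] by simp
    qed
    have Bn: "B \<le> n"
    proof (rule ccontr)
      assume "\<not> B \<le> n"
      then have "real (n + 2) ^ Suc k \<le> real (Suc B) ^ Suc k" by (intro power_mono) auto
      with n Bt show False by simp
    qed
    define a where "a = smul (complex_of_real (1 / P)) x"
    have a: "nrm j a = nrm j x / P" for j
      unfolding a_def sc using P by (simp add: norm_divide)
    have "nrm m a \<le> real (n + 2) powr (real (k + 2) * (1 + \<rho> m))" if "q \<le> m" "m \<le> N" for m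
    proof -
      have "nrm m x * P powr \<rho> m \<le> C * (nrm m x * P powr \<rho> m)"
        using mult_right_mono[OF C1, of "nrm m x * P powr \<rho> m"] nn[of m x] by simp
      also have "\<dots> \<le> X powr (1 + \<rho> m)"
        using x[of m] that by (simp add: X_def P_def mult_ac)
      finally have "nrm m a \<le> t powr (1 + \<rho> m)"
        using P X by (simp add: a t_def powr_divide powr_add field_simps)
      also have "\<dots> \<le> (real (n + 2) ^ Suc k) powr (1 + \<rho> m)"
        using n t0 \<rho>_pos[of m] by (intro powr_mono2) auto
      also have "\<dots> = real (n + 2) powr (real (Suc k) * (1 + \<rho> m))"
        by (subst powr_realpow[symmetric]) (auto simp: powr_powr)
      also have "\<dots> \<le> real (n + 2) powr (real (k + 2) * (1 + \<rho> m))"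
        using \<rho>_pos[of m] by (intro powr_mono mult_right_mono) auto
      finally show ?thesis .
    qed
    moreover have "nrm k a \<le> 1" using P by (simp add: a P_def[symmetric])
    moreover have "real (Suc n) ^ Suc k \<le> nrm q a" using nt by (simp add: a t_def X_def)
    ultimately show ?thesis using Bn by blast
  qed
qed

text \<open>The sequence \<open>b\<close> carries peaks at the places \<open>\<nu> i\<close>, the
  \<open>i\<close>-th one made for \<open>k = \<kappa> i\<close>. In a fixed \<open>nrm j\<close>,
  peaks with \<open>\<kappa> i \<ge> j\<close> are at most 1, and the finitely many values
  \<open>\<kappa> i < j\<close> share one exponent. No \<open>k\<close> is uniform, since
  \<open>nrm (q k)\<close> grows like the power \<open>k + 1\<close> along the peaks made for
  \<open>k\<close>.\<close>

lemma not_LB_infinity_growth: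
  fixes smul :: "complex \<Rightarrow> 'a::ab_group_add \<Rightarrow> 'a" and nrm :: "nat \<Rightarrow> 'a \<Rightarrow> real"
  assumes sn: "\<And>k. seminorm smul (nrm k)" and inc: "incseq nrm" and notLB: "\<not> LB_infinity nrm"
  shows "\<exists>b :: nat \<Rightarrow> 'a. (\<forall>j. \<exists>(k::nat) M. \<forall>n. nrm j (b n) \<le> M * real (Suc n) ^ k) \<and>
    \<not> (\<exists>k::nat. \<forall>j. \<exists>M. \<forall>n. nrm j (b n) \<le> M * real (Suc n) ^ k)"
proof -
  have nn: "0 \<le> nrm j x" and sc: "nrm j (smul c x) = cmod c * nrm j x" for j x c
    using sn[of j] by (auto simp: seminorm_def)
  have mono: "nrm i x \<le> nrm j x" if "i \<le> j" for i j x
    using incseqD[OF inc that] by (simp add: le_fun_def)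
  define T where "T \<rho> p q n0 C x \<longleftrightarrow> (\<exists>m. q \<le> m \<and> m \<le> n0 \<and>
      nrm q x powr (1 + \<rho> m) \<le> C * nrm m x * nrm p x powr \<rho> m)" for \<rho> p q n0 C x
  obtain \<rho> :: "nat \<Rightarrow> real" where \<rho>_pos: "\<And>m. 0 < \<rho> m"
    and no: "\<not> (\<exists>p. \<forall>q. \<exists>n0\<ge>q. \<exists>C>0. \<forall>x. T \<rho> p q n0 C x)"
    using notLB unfolding LB_infinity_def T_def[symmetric] by blast
  have not_T: "\<not> T \<rho> p q n0 C x \<longleftrightarrow> (\<forall>m. q \<le> m \<longrightarrow> m \<le> n0 \<longrightarrow>
      C * nrm m x * nrm p x powr \<rho> m < nrm q x powr (1 + \<rho> m))" for p q n0 C x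
    unfolding T_def not_le[symmetric] by blast
  have "\<forall>p. \<exists>q. \<forall>n0\<ge>q. \<forall>C>0. \<exists>x. \<not> T \<rho> p q n0 C x"
    using no by simp
  then have "\<forall>p. \<exists>q. \<forall>n0\<ge>q. \<forall>C>0. \<exists>x. \<forall>m. q \<le> m \<longrightarrow> m \<le> n0 \<longrightarrow>
        C * nrm m x * nrm p x powr \<rho> m < nrm q x powr (1 + \<rho> m)"
    unfolding not_T .
  from choice[OF this] obtain q where
    q: "\<And>p n0 C. q p \<le> n0 \<Longrightarrow> 0 < C \<Longrightarrow> \<exists>x. \<forall>m. q p \<le> m \<longrightarrow> m \<le> n0 \<longrightarrow>
        C * nrm m x * nrm p x powr \<rho> m < nrm (q p) x powr (1 + \<rho> m)"
    by blast
  \<comment> \<open>Decoding pairs makes \<open>\<kappa>\<close> take every value infinitely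
    often.\<close>
  define \<kappa> where "\<kappa> i = fst (prod_decode i)" for i
  define Pr where "Pr i z \<longleftrightarrow> (case z of (n, a) \<Rightarrow> nrm (\<kappa> i) a \<le> 1 \<and>
      real (Suc n) ^ Suc (\<kappa> i) \<le> nrm (q (\<kappa> i)) a \<and>
      (\<forall>m. q (\<kappa> i) \<le> m \<longrightarrow> m \<le> i \<longrightarrow> nrm m a \<le> real (n + 2) powr (real (\<kappa> i + 2) * (1 + \<rho> m))))"
    for i and z :: "nat \<times> 'a"
  have ex: "\<exists>z. Pr i z \<and> B \<le> fst z" for i B
  proof -
    obtain n a where "B \<le> n" "nrm (\<kappa> i) a \<le> 1" "real (Suc n) ^ Suc (\<kappa> i) \<le> nrm (q (\<kappa> i)) a"
      "\<forall>m. q (\<kappa> i) \<le> m \<longrightarrow> m \<le> i \<longrightarrow> nrm m a \<le> real (n + 2) powr (real (\<kappa> i + 2) * (1 + \<rho> m))"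
      using not_LB_infinity_peak[where \<rho> = \<rho> and B = B and N = i, OF sn inc \<rho>_pos q[of "\<kappa> i"]]
      by blast
    then show ?thesis by (intro exI[of _ "(n, a)"]) (simp add: Pr_def)
  qed
  have "\<exists>f. \<forall>i. Pr i (f i) \<and> fst (f i) < fst (f (Suc i))"
  proof (rule dependent_nat_choice)
    show "\<exists>z. Pr 0 z" using ex by blast
    show "\<exists>z'. Pr (Suc i) z' \<and> fst z < fst z'" for z i
      using ex[of "Suc i" "Suc (fst z)"] by (auto simp: Suc_le_eq)
  qed
  then obtain f where f: "\<And>i. Pr i (f i)" "\<And>i. fst (f i) < fst (f (Suc i))" by blast
  define \<nu> \<alpha> where "\<nu> i = fst (f i)" and "\<alpha> i = snd (f i)" for i
  have sm: "strict_mono \<nu>" using f(2) by (simp add: strict_mono_Suc_iff \<nu>_def)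
  have \<alpha>1: "nrm (\<kappa> i) (\<alpha> i) \<le> 1"
    and \<alpha>q: "real (Suc (\<nu> i)) ^ Suc (\<kappa> i) \<le> nrm (q (\<kappa> i)) (\<alpha> i)"
    and \<alpha>m: "q (\<kappa> i) \<le> m \<Longrightarrow> m \<le> i \<Longrightarrow> nrm m (\<alpha> i) \<le> real (\<nu> i + 2) powr (real (\<kappa> i + 2) * (1 + \<rho> m))"
    for i m
    using f(1)[of i] by (auto simp: Pr_def \<nu>_def \<alpha>_def split: prod.splits)
  \<comment> \<open>Off the peaks, \<open>b\<close> is a vector on which every seminorm vanishes by
    homogeneity.\<close>
  define b where "b n = (if n \<in> range \<nu> then \<alpha> (inv \<nu> n) else smul 0 (\<alpha> 0))" for n
  have b_\<nu>: "b (\<nu> i) = \<alpha> i" for i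
    using inv_f_f[OF strict_mono_imp_inj_on[OF sm], of i] by (simp add: b_def)
  have b_0: "nrm j (b n) = 0" if "n \<notin> range \<nu>" for j n using that by (simp add: b_def sc)
  have "\<exists>(k::nat) M. \<forall>n. nrm j (b n) \<le> M * real (Suc n) ^ k" for j
  proof -
    \<comment> \<open>The bound on a peak holds only for indices between
      \<open>q (\<kappa> i)\<close> and \<open>i\<close>. So \<open>nrm j\<close> is enlarged to
      \<open>nrm J\<close>, where \<open>J\<close> lies above all \<open>q k\<close> with
      \<open>k < j\<close>; peaks with \<open>i \<ge> J\<close> are then covered.\<close>
    define J where "J = j + (\<Sum>k<j. q k)"
    have qJ: "q k \<le> J" if "k < j" for k
      using member_le_sum[of k "{..<j}" q] that by (simp add: J_def)
    define K where "K = nat \<lceil>real (j + 2) * (1 + \<rho> J)\<rceil>"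
    have K: "real (j + 2) * (1 + \<rho> J) \<le> real K" unfolding K_def by linarith
    \<comment> \<open>The factor \<open>2 ^ K\<close> comes from
      \<open>n + 2 \<le> 2 * (n + 1)\<close>; the sum takes care of the first \<open>J\<close>
      peaks.\<close>
    define M where "M = 2 ^ K + (\<Sum>i<J. nrm j (\<alpha> i))"
    have late: "nrm j (\<alpha> i) \<le> 2 ^ K * real (Suc (\<nu> i)) ^ K" if "J \<le> i" for i
    proof (cases "j \<le> \<kappa> i")
      case True
      have "nrm j (\<alpha> i) \<le> 1" using mono[OF True] \<alpha>1 order_trans by blast
      also have "1 \<le> (2 * real (Suc (\<nu> i))) ^ K" by (intro one_le_power) simp
      finally show ?thesis by (simp only: power_mult_distrib)
    next
      case False
      have "nrm j (\<alpha> i) \<le> nrm J (\<alpha> i)" by (intro mono) (simp add: J_def)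
      also have "\<dots> \<le> real (\<nu> i + 2) powr (real (\<kappa> i + 2) * (1 + \<rho> J))"
        using False that by (intro \<alpha>m qJ) auto
      also have "\<dots> \<le> real (\<nu> i + 2) powr real K"
      proof (rule powr_mono)
        have "real (\<kappa> i + 2) * (1 + \<rho> J) \<le> real (j + 2) * (1 + \<rho> J)"
          using False \<rho>_pos[of J] by (intro mult_right_mono) auto
        with K show "real (\<kappa> i + 2) * (1 + \<rho> J) \<le> real K" by linarith
      qed simp
      also have "\<dots> = real (\<nu> i + 2) ^ K" by (rule powr_realpow) simp
      also have "\<dots> \<le> (2 * real (Suc (\<nu> i))) ^ K" by (intro power_mono) auto
      finally show ?thesis by (simp only: power_mult_distrib)
    qed
    have "nrm j (b n) \<le> M * real (Suc n) ^ K" for n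
    proof (cases "n \<in> range \<nu>")
      case False
      have "0 \<le> M" by (simp add: M_def nn sum_nonneg)
      then show ?thesis using False by (simp add: b_0)
    next
      case True
      then obtain i where i: "n = \<nu> i" by blast
      have w: "1 \<le> real (Suc n) ^ K" by (intro one_le_power) simp
      have s: "0 \<le> (\<Sum>i<J. nrm j (\<alpha> i))" by (intro sum_nonneg nn)
      show ?thesis
      proof (cases "J \<le> i")
        case True
        have "nrm j (b n) \<le> 2 ^ K * real (Suc n) ^ K" using late[OF True] by (simp add: i b_\<nu>)
        also have "\<dots> \<le> M * real (Suc n) ^ K" using s by (intro mult_right_mono) (auto simp: M_def)
        finally show ?thesis .
      next
        case False
        then have "nrm j (b n) \<le> (\<Sum>i<J. nrm j (\<alpha> i))"
          unfolding i b_\<nu> by (intro member_le_sum nn) auto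
        also have "\<dots> \<le> M * 1" by (simp add: M_def)
        also have "\<dots> \<le> M * real (Suc n) ^ K" using w s by (intro mult_left_mono) (auto simp: M_def)
        finally show ?thesis .
      qed
    qed
    then show ?thesis by blast
  qed
  moreover have False if uniform: "\<And>j. \<exists>M. \<forall>n. nrm j (b n) \<le> M * real (Suc n) ^ k" for k
  proof -
    obtain M where M: "\<And>n. nrm (q k) (b n) \<le> M * real (Suc n) ^ k" using uniform by blast
    \<comment> \<open>The second component of the pair pushes \<open>i\<close>, and with it
      \<open>\<nu> i \<ge> i\<close>, beyond \<open>M\<close> while \<open>\<kappa> i\<close> stays
      equal to \<open>k\<close>.\<close>
    obtain l :: nat where l: "M < l" using reals_Archimedean2 by blast
    define i where "i = prod_encode (k, l)"
    have "\<kappa> i = k" by (simp add: \<kappa>_def i_def)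
    then have "real (Suc (\<nu> i)) * real (Suc (\<nu> i)) ^ k \<le> nrm (q k) (b (\<nu> i))"
      using \<alpha>q[of i] by (simp add: b_\<nu>)
    also have "\<dots> \<le> M * real (Suc (\<nu> i)) ^ k" by (rule M)
    finally have "real (Suc (\<nu> i)) \<le> M"
      by (rule mult_right_le_imp_le) simp
    moreover have "l \<le> \<nu> i"
      using le_prod_encode_2[of l k] seq_suble[OF sm, of i] by (simp add: i_def)
    ultimately show False using l by simp
  qed
  ultimately show ?thesis by blast
qed

subsection \<open>Growth of coefficients and abscissas\<close>

lemma abscissa_of_convergence_finite_iff:
  "abscissa_of_convergence smul a < \<infinity> \<longleftrightarrow> (\<exists>r. \<forall>s. r < Re s \<longrightarrow> dirichlet_converges smul a s)"
  unfolding abscissa_of_convergence_def Inf_less_iff by force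

lemma cmod_inverse_powr_Suc: "cmod (1 / of_nat (Suc n) powr s) = real (Suc n) powr (- Re s)"
proof -
  have "cmod (of_nat (Suc n) powr s) = real (Suc n) powr Re s"
    by (subst norm_powr_real_powr) (auto simp del: of_nat_Suc)
  then show ?thesis by (simp add: norm_divide powr_minus_divide del: of_nat_Suc)
qed

lemma dirichlet_converges_imp_growth:
  fixes smul :: "complex \<Rightarrow> 'a::topological_ab_group_add \<Rightarrow> 'a"
  assumes conv: "dirichlet_converges smul a s"
    and q: "seminorm smul q" "continuous_on UNIV q"
  shows "\<exists>M. \<forall>n. q (a (Suc n)) \<le> M * real (Suc n) powr Re s"
proof -
  define x where "x n = smul (1 / of_nat (Suc n) powr s) (a (Suc n))" for n
  obtain l where l: "(\<lambda>n. \<Sum>i<n. x i) \<longlonglongrightarrow> l"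
    using conv by (auto simp: dirichlet_converges_def summable_def sums_def x_def)
  have "(\<lambda>n. (\<Sum>i<Suc n. x i) - (\<Sum>i<n. x i)) \<longlonglongrightarrow> l - l"
    by (intro tendsto_diff l LIMSEQ_Suc[OF l])
  then have "x \<longlonglongrightarrow> 0" by simp
  then have "(\<lambda>n. q (x n)) \<longlonglongrightarrow> q 0"
    by (intro continuous_on_tendsto_compose[OF q(2)]) auto
  then obtain M where M: "\<And>n. norm (q (x n)) \<le> M"
    using convergent_imp_Bseq[OF convergentI] Bseq_def by metis
  have "q (a (Suc n)) \<le> M * real (Suc n) powr Re s" for n
  proof -
    have "q (x n) = real (Suc n) powr (- Re s) * q (a (Suc n))"
      using q(1) by (simp add: seminorm_def x_def cmod_inverse_powr_Suc del: of_nat_Suc)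
    then have "real (Suc n) powr (- Re s) * q (a (Suc n)) \<le> M" using M[of n] by simp
    then show ?thesis by (simp add: powr_minus field_simps del: of_nat_Suc)
  qed
  then show ?thesis by blast
qed

text \<open>Convergence at the single point \<open>s = k\<close> bounds the terms in every
  continuous seminorm, so the exponent does not depend on \<open>q\<close>.\<close>

lemma finite_abscissa_imp_growth:
  fixes smul :: "complex \<Rightarrow> 'a::topological_ab_group_add \<Rightarrow> 'a"
  assumes "abscissa_of_convergence smul a < \<infinity>"
  shows "\<exists>k::nat. \<forall>q. seminorm smul q \<and> continuous_on UNIV q \<longrightarrow>
    (\<exists>M. \<forall>n. q (a (Suc n)) \<le> M * real (Suc n) ^ k)"
proof -
  obtain r where r: "\<And>s. r < Re s \<Longrightarrow> dirichlet_converges smul a s"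
    using assms unfolding abscissa_of_convergence_finite_iff by blast
  obtain k :: nat where k: "r < k" using reals_Archimedean2 by blast
  have "\<exists>M. \<forall>n. q (a (Suc n)) \<le> M * real (Suc n) ^ k"
    if "seminorm smul q" "continuous_on UNIV q" for q
    using dirichlet_converges_imp_growth[OF r[of "of_nat k"] that] k
    by (simp add: powr_realpow del: of_nat_Suc)
  then show ?thesis by blast
qed

text \<open>Comparison with the powers of exponent \<open>k - Re s < -1\<close>. It serves both the
  seminorms of the space and \<open>cmod\<close> for scalar series.\<close>

lemma summable_dirichlet_majorant:
  assumes q: "seminorm smul q" and bound: "\<And>n. q (a (Suc n)) \<le> M * real (Suc n) ^ k"
    and s: "real k + 1 < Re s"
  shows "summable (\<lambda>n. q (smul (1 / of_nat (Suc n) powr s) (a (Suc n))))"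
proof (rule summable_comparison_test')
  have "summable (\<lambda>n. real n powr (real k - Re s))"
    using s by (simp add: summable_real_powr_iff)
  then show "summable (\<lambda>n. M * real (Suc n) powr (real k - Re s))"
    by (intro summable_mult) (simp add: summable_Suc_iff[of "\<lambda>n. real n powr (real k - Re s)"] del: of_nat_Suc)
  fix n
  have "q (smul (1 / of_nat (Suc n) powr s) (a (Suc n))) = real (Suc n) powr (- Re s) * q (a (Suc n))"
    using q by (simp add: seminorm_def cmod_inverse_powr_Suc del: of_nat_Suc)
  also have "\<dots> \<le> real (Suc n) powr (- Re s) * (M * real (Suc n) ^ k)"
    by (intro mult_left_mono bound) simp
  also have "\<dots> = M * real (Suc n) powr (real k - Re s)"
    by (simp add: powr_diff powr_minus powr_realpow field_simps del: of_nat_Suc)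
  finally show "norm (q (smul (1 / of_nat (Suc n) powr s) (a (Suc n)))) \<le> M * real (Suc n) powr (real k - Re s)"
    using q by (simp add: seminorm_def)
qed

section \<open>Absolute summability in Frechet spaces\<close>

lemma seminorm_zero:
  assumes "vector_space smul" "seminorm smul q"
  shows "q 0 = 0"
proof -
  interpret vector_space smul by (fact assms(1))
  have "q (smul 0 0) = cmod 0 * q 0" using assms(2) by (simp only: seminorm_def)
  then show ?thesis by simp
qed

lemma seminorm_sum_le:
  assumes "vector_space smul" "seminorm smul q"
  shows "q (sum x A) \<le> (\<Sum>i\<in>A. q (x i))"
proof (induction A rule: infinite_finite_induct)
  case (insert i A)
  have "q (x i + sum x A) \<le> q (x i) + q (sum x A)" using assms(2) by (simp add: seminorm_def)
  with insert show ?case by simp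
qed (simp_all add: seminorm_zero[OF assms])

lemma frechet_space_absolutely_summable:
  fixes smul :: "complex \<Rightarrow> 'a::topological_ab_group_add \<Rightarrow> 'a"
  assumes "frechet_space smul" and sys: "increasing_fundamental_system smul nrm"
    and abs: "\<And>j. summable (\<lambda>n. nrm j (x n))"
  shows "summable x"
proof -
  interpret frechet_space smul by (fact assms(1))
  have sn: "seminorm smul (nrm j)" for j
    using sys by (simp add: increasing_fundamental_system_def)
  obtain d :: "'a \<Rightarrow> 'a \<Rightarrow> real" where ms: "Metric_space UNIV d"
    and inv: "\<And>x y z. d (x + z) (y + z) = d x y"
    and top: "Metric_space.mtopology UNIV d = euclidean" and compl: "Metric_space.mcomplete UNIV d"
    using complete_invariant_metric by blast
  interpret M: Metric_space UNIV d by (fact ms)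
  define S where "S n = (\<Sum>i<n. x i)" for n
  have "M.MCauchy S"
    unfolding M.MCauchy_def
  proof (intro conjI allI impI)
    fix \<epsilon> :: real assume "\<epsilon> > 0"
    have "open (M.mball 0 \<epsilon>)"
      using M.openin_mball[of 0 \<epsilon>] unfolding top by (simp only: open_openin)
    with \<open>\<epsilon> > 0\<close> obtain k \<delta> where \<delta>: "\<delta> > 0" "{y. nrm k y < \<delta>} \<subseteq> M.mball 0 \<epsilon>"
      using sys unfolding increasing_fundamental_system_def
      using M.centre_in_mball_iff[of 0 \<epsilon>] by blast
    obtain N where N: "\<And>m n. N \<le> m \<Longrightarrow> norm (\<Sum>i\<in>{m..<n}. nrm k (x i)) < \<delta>"
      using abs[of k] \<delta>(1) unfolding summable_Cauchy by blast
    \<comment> \<open>Invariance turns the distance of two partial sums into the distance of a block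
      from 0, where balls contain seminorm balls.\<close>
    have close: "d (S m) (S n) < \<epsilon>" if "N \<le> m" "m \<le> n" for m n
    proof -
      have diff: "S n - S m = (\<Sum>i\<in>{m..<n}. x i)"
        using sum_diff_nat_ivl[of 0 m n x] that by (simp add: S_def atLeast0LessThan)
      have "nrm k (S n - S m) \<le> (\<Sum>i\<in>{m..<n}. nrm k (x i))"
        unfolding diff by (rule seminorm_sum_le[OF vector_space_axioms sn])
      also have "\<dots> < \<delta>" using N[OF that(1), of n] by simp
      finally have "d 0 (S n - S m) < \<epsilon>" using \<delta>(2) by auto
      then show ?thesis using inv[of 0 "S m" "S n - S m"] by simp
    qed
    have "d (S m) (S n) < \<epsilon>" if "N \<le> m" "N \<le> n" for m n
      using close[of m n] close[of n m] that M.commute[of "S m" "S n"] by linarith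
    then show "\<exists>N. \<forall>n n'. N \<le> n \<longrightarrow> N \<le> n' \<longrightarrow> d (S n) (S n') < \<epsilon>" by blast
  qed simp
  then obtain l where "limitin M.mtopology S l sequentially"
    using compl unfolding M.mcomplete_def by blast
  then have "S \<longlonglongrightarrow> l" by (simp only: top limitin_canonical_iff)
  then show ?thesis unfolding summable_def sums_def S_def[abs_def] by blast
qed

section \<open>Continuous functionals and dominating seminorms\<close>

lemma continuous_on_linear_dominated:
  fixes smul :: "complex \<Rightarrow> 'a::topological_ab_group_add \<Rightarrow> 'a"
  assumes f: "Vector_Spaces.linear smul (*) f" and le: "\<And>x. cmod (f x) \<le> q x"
    and q: "continuous_on UNIV q" "q 0 = 0"
  shows "continuous_on UNIV f"
proof -
  interpret Vector_Spaces.linear smul "(*)" f by (fact f)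
  have "(f \<longlongrightarrow> f x) (at x)" for x
  proof -
    have "((\<lambda>y. y - x) \<longlongrightarrow> x - x) (at x)" by (intro tendsto_intros)
    then have "((\<lambda>y. q (y - x)) \<longlongrightarrow> q 0) (at x)"
      by (intro continuous_on_tendsto_compose[OF q(1)]) auto
    then have lim: "((\<lambda>y. q (y - x)) \<longlongrightarrow> 0) (at x)" by (simp only: q(2))
    have "norm (f y - f x) \<le> q (y - x)" for y using le[of "y - x"] by (simp only: diff)
    then have "((\<lambda>y. f y - f x) \<longlongrightarrow> 0) (at x)"
      by (intro Lim_null_comparison[OF _ lim] always_eventually allI)
    then show ?thesis by (rule LIM_zero_cancel)
  qed
  then show ?thesis by (simp add: continuous_on_def)
qed

lemma topological_dual_dominated:
  fixes smul :: "complex \<Rightarrow> 'a::topological_ab_group_add \<Rightarrow> 'a"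
  assumes vs: "vector_space smul" and sys: "increasing_fundamental_system smul nrm"
    and f: "f \<in> topological_dual smul"
  shows "\<exists>k C. 0 \<le> C \<and> (\<forall>x. cmod (f x) \<le> C * nrm k x)"
proof -
  have lin: "Vector_Spaces.linear smul (*) f" and cont: "continuous_on UNIV f"
    using f by (auto simp: topological_dual_def)
  interpret Vector_Spaces.linear smul "(*)" f by (fact lin)
  have "open (f -` ball 0 1)" using cont by (simp add: open_vimage)
  moreover have "0 \<in> f -` ball 0 1" by (simp add: zero)
  ultimately obtain k \<epsilon> where \<epsilon>: "\<epsilon> > 0" "{x. nrm k x < \<epsilon>} \<subseteq> f -` ball 0 1"
    using sys unfolding increasing_fundamental_system_def by blast
  have nn: "0 \<le> nrm k x" and sc: "nrm k (smul c x) = cmod c * nrm k x" for x c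
    using sys by (auto simp: increasing_fundamental_system_def seminorm_def)
  have "cmod (f x) \<le> (1 / \<epsilon>) * nrm k x" for x
  \<comment> \<open>The slack \<open>e\<close> keeps the scaling radius \<open>r\<close> positive
    even when \<open>nrm k x = 0\<close>.\<close>
  proof (rule field_le_epsilon)
    fix e :: real assume e: "e > 0"
    define r where "r = nrm k x + e * \<epsilon>"
    have r: "nrm k x < r" "r > 0" using e \<epsilon>(1) nn[of x] by (auto simp: r_def add_nonneg_pos)
    have "nrm k (smul (of_real (\<epsilon> / r)) x) < \<epsilon>"
      using r \<epsilon>(1) by (simp add: sc norm_divide norm_mult field_simps)
    then have "cmod (f (smul (of_real (\<epsilon> / r)) x)) < 1" using \<epsilon>(2) by auto
    then have "\<epsilon> / r * cmod (f x) < 1"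
      using r \<epsilon>(1) by (simp add: scale norm_mult norm_divide)
    then have "cmod (f x) < r / \<epsilon>" using r \<epsilon>(1) by (simp add: field_simps)
    also have "r / \<epsilon> = 1 / \<epsilon> * nrm k x + e" using \<epsilon>(1) by (simp add: r_def field_simps)
    finally show "cmod (f x) \<le> 1 / \<epsilon> * nrm k x + e" by simp
  qed
  then show ?thesis using \<epsilon>(1) by (intro exI[of _ k] exI[of _ "1 / \<epsilon>"]) simp
qed

lemma seminorm_cmod: "seminorm (*) cmod"
  by (simp add: seminorm_def norm_mult norm_triangle_ineq)

section \<open>The two implications\<close>

lemma LB_infinity_imp_finite_abscissa:
  fixes smul :: "complex \<Rightarrow> 'a::topological_ab_group_add \<Rightarrow> 'a" and a :: "nat \<Rightarrow> 'a"
  assumes "frechet_space smul" "increasing_fundamental_system smul nrm" and LB: "LB_infinity nrm"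
    and weak: "\<forall>f \<in> topological_dual smul. abscissa_of_convergence (*) (\<lambda>n. f (a n)) < \<infinity>"
  shows "abscissa_of_convergence smul a < \<infinity>"
proof -
  have vs: "vector_space smul"
    using assms(1) by (simp add: frechet_space_def complex_tvs_def)
  have sn: "seminorm smul (nrm j)" and cont: "continuous_on UNIV (nrm j)" for j
    using assms(2) by (auto simp: increasing_fundamental_system_def)
  have nn: "0 \<le> nrm j x" for j x using sn[of j] by (simp add: seminorm_def)
  have "\<exists>(k::nat) M. \<forall>n. nrm j (a (Suc n)) \<le> M * real (Suc n) ^ k" for j
  proof (rule weakly_polynomial_growth_imp_seminorm[OF vs sn])
    fix f assume f: "Vector_Spaces.linear smul (*) f" "\<forall>y. cmod (f y) \<le> 2 * nrm j y"
    have "nrm j 0 = 0" by (rule seminorm_zero[OF vs sn])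
    then have "continuous_on UNIV f"
      using f(2) by (intro continuous_on_linear_dominated[OF f(1), of "\<lambda>y. 2 * nrm j y"]
          continuous_on_mult_left cont) auto
    with f(1) have "f \<in> topological_dual smul" by (simp add: topological_dual_def)
    then have "abscissa_of_convergence (*) (\<lambda>n. f (a n)) < \<infinity>" using weak by blast
    from finite_abscissa_imp_growth[OF this] seminorm_cmod
    show "\<exists>(k::nat) M. \<forall>n. cmod (f (a (Suc n))) \<le> M * real (Suc n) ^ k"
      using continuous_on_norm_id by blast
  qed
  then obtain k :: nat where k: "\<And>j. \<exists>M. \<forall>n. nrm j (a (Suc n)) \<le> M * real (Suc n) ^ k"
    using LB_infinity_uniform_growth[OF LB nn, of "\<lambda>n. a (Suc n)"] by blast
  \<comment> \<open>Since \<open>k\<close> is the same for all \<open>j\<close>, one half-plane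
    gives absolute summability in every seminorm simultaneously.\<close>
  have "dirichlet_converges smul a s" if s: "real k + 1 < Re s" for s
    unfolding dirichlet_converges_def
  proof (rule frechet_space_absolutely_summable[OF assms(1,2)])
    fix j
    obtain M where "\<And>n. nrm j (a (Suc n)) \<le> M * real (Suc n) ^ k" using k by blast
    from summable_dirichlet_majorant[OF sn this s]
    show "summable (\<lambda>n. nrm j (smul (1 / of_nat (Suc n) powr s) (a (Suc n))))" .
  qed
  then show "abscissa_of_convergence smul a < \<infinity>"
    unfolding abscissa_of_convergence_finite_iff by blast
qed

text \<open>A continuous functional is dominated by a multiple of a single \<open>nrm j\<close>, so
  it only sees the exponent for that \<open>j\<close>. A finite abscissa of the vector-valued series
  would need one exponent for all \<open>j\<close>.\<close>

lemma not_LB_infinity_imp_infinite_abscissa: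
  fixes smul :: "complex \<Rightarrow> 'a::topological_ab_group_add \<Rightarrow> 'a"
  assumes "vector_space smul" and sys: "increasing_fundamental_system smul nrm"
    and notLB: "\<not> LB_infinity nrm"
  shows "\<exists>a :: nat \<Rightarrow> 'a.
    (\<forall>f \<in> topological_dual smul. abscissa_of_convergence (*) (\<lambda>n. f (a n)) < \<infinity>) \<and>
    \<not> abscissa_of_convergence smul a < \<infinity>"
proof -
  note vs = assms(1)
  have sn: "seminorm smul (nrm j)" and cont: "continuous_on UNIV (nrm j)" for j
    using sys by (auto simp: increasing_fundamental_system_def)
  have inc: "incseq nrm" using sys by (simp add: increasing_fundamental_system_def)
  from not_LB_infinity_growth[OF sn inc notLB] obtain b :: "nat \<Rightarrow> 'a" where
    b: "\<And>j. \<exists>(k::nat) M. \<forall>n. nrm j (b n) \<le> M * real (Suc n) ^ k"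
    and not_uniform: "\<not> (\<exists>k::nat. \<forall>j. \<exists>M. \<forall>n. nrm j (b n) \<le> M * real (Suc n) ^ k)"
    by blast
  \<comment> \<open>The shift gives \<open>a (Suc n) = b n\<close>, since the series starts at
    1.\<close>
  define a where "a n = b (n - 1)" for n
  have "abscissa_of_convergence (*) (\<lambda>n. f (a n)) < \<infinity>" if f: "f \<in> topological_dual smul" for f
  proof -
    obtain j C where C: "0 \<le> C" "\<And>x. cmod (f x) \<le> C * nrm j x"
      using topological_dual_dominated[OF vs sys f] by blast
    obtain k :: nat and M where M: "\<And>n. nrm j (b n) \<le> M * real (Suc n) ^ k"
      using b by blast
    have "cmod (f (a (Suc n))) \<le> (C * M) * real (Suc n) ^ k" for n
      using order_trans[OF C(2) mult_left_mono[OF M C(1)], of n] by (simp add: a_def mult.assoc)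
    from summable_dirichlet_majorant[OF seminorm_cmod this]
    have "dirichlet_converges (*) (\<lambda>n. f (a n)) s" if "real k + 1 < Re s" for s
      using that unfolding dirichlet_converges_def by (blast intro: summable_norm_cancel)
    then show ?thesis unfolding abscissa_of_convergence_finite_iff by blast
  qed
  moreover have "\<not> abscissa_of_convergence smul a < \<infinity>"
  proof
    assume "abscissa_of_convergence smul a < \<infinity>"
    from finite_abscissa_imp_growth[OF this] obtain k :: nat where
      "\<And>j. \<exists>M. \<forall>n. nrm j (a (Suc n)) \<le> M * real (Suc n) ^ k"
      using sn cont by blast
    then show False using not_uniform unfolding a_def diff_Suc_1 by blast
  qed
  ultimately show ?thesis by blast
qed

theorem theorem2p5:
  fixes smul :: "complex \<Rightarrow> 'a::topological_ab_group_add \<Rightarrow> 'a"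
    and nrm :: "nat \<Rightarrow> 'a \<Rightarrow> real"
  assumes "frechet_space smul"
    and "increasing_fundamental_system smul nrm"
  shows "LB_infinity nrm \<longleftrightarrow>
    (\<forall>a :: nat \<Rightarrow> 'a.
      (\<forall>f \<in> topological_dual smul. abscissa_of_convergence (*) (\<lambda>n. f (a n)) < \<infinity>) \<longrightarrow>
      abscissa_of_convergence smul a < \<infinity>)"
proof -
  have "vector_space smul"
    using assms(1) by (simp add: frechet_space_def complex_tvs_def)
  from not_LB_infinity_imp_infinite_abscissa[OF this assms(2)] show ?thesis
    using LB_infinity_imp_finite_abscissa[OF assms] by blast
qed

end
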